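(* Let $n \geq 1$ and let $\mathcal{A} \subset 2^{[n]}$ be a collection of odd-sized subsets of $[n]$ with $|\mathcal{A}| \geq n+1$. Then $\mathrm{op}(\mathcal{A}) \geq 3$.
   Context: $[n]=\{1,\ldots,n\}$ and $2^{[n]}$ denotes the collection of all subsets of $[n]$. For a collection $\mathcal{A}$ of sets, $\mathrm{op}(\mathcal{A})$ denotes the number of unordered pairs of distinct sets $A,B\in\mathcal{A}$ for which $|A\cap B|$ is odd. *)

theory Defs
  imports Main
begin

definition op_num :: "'a set set \<Rightarrow> nat" where
  "op_num \<A> = card {{A, B} | A B. A \<in> \<A> \<and> B \<in> \<A> \<and> A \<noteq> B \<and> odd (card (A \<inter> B))}"

end

theory Submission
  imports Defs
begin

text \<open>
  View sets as vectors over the field with two elements and call two distinct members of the family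
  adjacent if their intersection is odd. If a nonempty subfamily \<open>S\<close> sums to zero, pairing the sum
  with a member \<open>C\<close> of the family shows that \<open>C\<close> has an odd number of neighbours in \<open>S\<close> if
  \<open>C \<in> S\<close>, and an even number otherwise. Since there are more than \<open>n\<close> vectors, such an \<open>S\<close> exists;
  it contains adjacent \<open>a\<close>, \<open>b\<close>. Suppose there are at most two edges. If some member \<open>c\<close> is not
  orthogonal to \<open>a + b\<close>, the edges form a path on \<open>a\<close>, \<open>b\<close>, \<open>c\<close>, which contradicts the parity of the
  degrees. Otherwise the whole family lies in the hyperplane orthogonal to \<open>a + b\<close>, so removing \<open>a\<close>
  leaves \<open>n\<close> vectors in dimension \<open>n - 1\<close>, again with a vanishing subfamily \<open>S'\<close>. As only one edge
  avoids \<open>a\<close>, this \<open>S'\<close> consists of two vectors, which must be equal.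
\<close>

definition zero_sum :: "'a set set \<Rightarrow> bool" where
  "zero_sum S \<longleftrightarrow> (\<forall>x. even (card {A \<in> S. x \<in> A}))"

lemma even_card_sym_diff:
  assumes "finite A" "finite B"
  shows "even (card (sym_diff A B)) \<longleftrightarrow> (even (card A) \<longleftrightarrow> even (card B))"
proof -
  have "card A = card (A - B) + card (A \<inter> B)" "card B = card (B - A) + card (A \<inter> B)"
    using assms card_Int_Diff[of A B] card_Int_Diff[of B A] by (auto simp: Int_commute)
  moreover have "card (sym_diff A B) = card (A - B) + card (B - A)"
    using assms by (intro card_Un_disjoint) auto
  ultimately show ?thesis by auto
qed

text \<open>Both counts have the parity of the number of pairs \<open>(A, x)\<close> with
  \<open>A\<close> in \<open>S\<close> and \<open>x\<close> in \<open>A \<inter> C\<close>. In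
  vector terms, the scalar product with \<open>C\<close> commutes with summing over
  \<open>S\<close>.\<close>

lemma even_double_count:
  assumes "finite S" "finite C"
  shows "even (card {A \<in> S. odd (card (A \<inter> C))}) \<longleftrightarrow>
         even (card {x \<in> C. odd (card {A \<in> S. x \<in> A})})"
proof -
  have "(\<Sum>A\<in>S. card {x \<in> C. x \<in> A}) = (\<Sum>x\<in>C. card {A \<in> S. x \<in> A})"
    using assms by (intro sum_multicount_gen) auto
  moreover have "{x \<in> C. x \<in> A} = A \<inter> C" for A by auto
  ultimately have "(\<Sum>A\<in>S. card (A \<inter> C)) = (\<Sum>x\<in>C. card {A \<in> S. x \<in> A})" by simp
  then show ?thesis
    using even_sum_iff[OF assms(1), of "\<lambda>A. card (A \<inter> C)"]
      even_sum_iff[OF assms(2), of "\<lambda>x. card {A \<in> S. x \<in> A}"] by simp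
qed

lemma zero_sum_even_odd_intersections:
  assumes "zero_sum S" "finite S" "finite C"
  shows "even (card {A \<in> S. odd (card (A \<inter> C))})"
proof -
  have "{x \<in> C. odd (card {A \<in> S. x \<in> A})} = {}"
    using assms(1) by (auto simp: zero_sum_def)
  then show ?thesis unfolding even_double_count[OF assms(2,3)] by (simp only: card.empty even_zero)
qed

lemma zero_sum_pair_eq:
  assumes "zero_sum {A, B}"
  shows "A = B"
proof (rule ccontr)
  assume "A \<noteq> B"
  then obtain x where "x \<in> A \<longleftrightarrow> x \<notin> B" by blast
  then have "{C \<in> {A, B}. x \<in> C} = {A} \<or> {C \<in> {A, B}. x \<in> C} = {B}" by auto
  then have "card {C \<in> {A, B}. x \<in> C} = 1"
    by (metis is_singletonI is_singleton_altdef)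
  with assms show False by (metis zero_sum_def odd_one)
qed

text \<open>Pigeonhole takes the place of linear dependence: two of the \<open>2 ^ card F\<close>
  subfamilies have the same sum in \<open>V\<close>, and their symmetric difference sums to zero.
  \<open>V\<close> need not be a subspace.\<close>

lemma exists_zero_sum_subfamily:
  assumes "finite F" "finite V" "F \<subseteq> Pow X" "card V < 2 ^ card F"
    and val: "\<And>S. S \<subseteq> F \<Longrightarrow> {x \<in> X. odd (card {A \<in> S. x \<in> A})} \<in> V"
  obtains S where "S \<subseteq> F" "S \<noteq> {}" "zero_sum S"
proof -
  define w where "w S = {x \<in> X. odd (card {A \<in> S. x \<in> A})}" for S
  have "\<not> inj_on w (Pow F)"
  proof
    assume "inj_on w (Pow F)"
    then have "card (Pow F) \<le> card V"
      using val assms(2) by (intro card_inj_on_le) (auto simp: w_def)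
    then show False using assms(1,4) by (simp add: card_Pow)
  qed
  then obtain S T where ST: "S \<subseteq> F" "T \<subseteq> F" "S \<noteq> T" "w S = w T"
    by (auto simp: inj_on_def)
  then have fin: "finite S" "finite T" using assms(1) by (auto intro: finite_subset)
  have "zero_sum (sym_diff S T)"
    unfolding zero_sum_def
  proof
    fix x
    show "even (card {A \<in> sym_diff S T. x \<in> A})"
    proof (cases "x \<in> X")
      case True
      then have "even (card {A \<in> S. x \<in> A}) \<longleftrightarrow> even (card {A \<in> T. x \<in> A})"
        using ST(4) by (auto simp: w_def set_eq_iff)
      moreover have "{A \<in> sym_diff S T. x \<in> A} = sym_diff {A \<in> S. x \<in> A} {A \<in> T. x \<in> A}"
        by auto
      ultimately show ?thesis using even_card_sym_diff[of "{A \<in> S. x \<in> A}" "{A \<in> T. x \<in> A}"] fin by simp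
    next
      case False
      then have "{A \<in> sym_diff S T. x \<in> A} = {}" using ST(1,2) assms(3) by auto
      then show ?thesis by (simp only: card.empty even_zero)
    qed
  qed
  then show thesis using ST by (intro that[of "sym_diff S T"]) auto
qed

theorem theorem2:
  fixes n :: nat and \<A> :: "nat set set"
  assumes "n \<ge> 1"
    and "\<A> \<subseteq> Pow {1..n}"
    and "\<And>A. A \<in> \<A> \<Longrightarrow> odd (card A)"
    and "card \<A> \<ge> n + 1"
  shows "op_num \<A> \<ge> 3"
proof (rule ccontr)
  assume few: "\<not> op_num \<A> \<ge> 3"
  define E where "E = {{A, B} | A B. A \<in> \<A> \<and> B \<in> \<A> \<and> A \<noteq> B \<and> odd (card (A \<inter> B))}"
  have finA: "finite \<A>" using assms(2) finite_subset by blast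
  have "E \<subseteq> Pow \<A>" by (auto simp: E_def)
  then have finE: "finite E" using finA by (simp add: finite_subset)
  have two_edges: "e = f \<or> e = g \<or> f = g" if "e \<in> E" "f \<in> E" "g \<in> E" for e f g
  proof (rule ccontr)
    assume "\<not> ?thesis"
    then have "card {e, f, g} = 3" by simp
    moreover have "card {e, f, g} \<le> card E" using that finE by (intro card_mono) auto
    ultimately show False using few by (simp add: op_num_def E_def)
  qed
  have edgeI: "{A, B} \<in> E" if "A \<in> \<A>" "B \<in> \<A>" "A \<noteq> B" "odd (card (A \<inter> B))" for A B
    using that by (auto simp: E_def)
  have fin: "finite A" if "A \<in> \<A>" for A using that assms(2) finite_subset by blast
  have parity: "even (card {A \<in> S. odd (card (A \<inter> C))})"
    if "S \<subseteq> \<A>" "zero_sum S" "C \<in> \<A>" for S C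
    using that finA fin by (intro zero_sum_even_odd_intersections) (auto intro: finite_subset)
  \<comment> \<open>As \<open>card A\<close> is odd, \<open>A\<close> counts itself in
    \<open>parity\<close>, so an even count forces a further member.\<close>
  have neighbour: "\<exists>B\<in>S. B \<noteq> A \<and> odd (card (A \<inter> B))"
    if "S \<subseteq> \<A>" "zero_sum S" "A \<in> S" for S A
  proof (rule ccontr)
    assume "\<not> ?thesis"
    then have "{B \<in> S. odd (card (B \<inter> A))} = {A}"
      using that assms(3) by (auto simp: Int_commute)
    then show False using parity[OF that(1,2), of A] that by auto
  qed
  have "card (Pow {1..n}) < 2 ^ card \<A>" using assms(4) by (simp add: card_Pow)
  then obtain S where S: "S \<subseteq> \<A>" "S \<noteq> {}" "zero_sum S"
    using exists_zero_sum_subfamily[of \<A> "Pow {1..n}" "{1..n}"] finA assms(2) by blast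
  then obtain a where "a \<in> S" by blast
  with neighbour[OF S(1,3) this] obtain b
    where ab: "a \<in> S" "b \<in> S" "a \<noteq> b" "odd (card (a \<inter> b))" by auto
  then have abA: "a \<in> \<A>" "b \<in> \<A>" using S by auto
  \<comment> \<open>Stated for \<open>p\<close>, \<open>q\<close> so that it serves both orders of
    \<open>a\<close>, \<open>b\<close>. The only edges are \<open>{p, q}\<close> and
    \<open>{c, p}\<close>: if \<open>c\<close> is in \<open>S\<close>, the count at \<open>p\<close>
    is three (\<open>p\<close> itself included), otherwise the count at \<open>c\<close> is
    one.\<close>
  have path: False
    if pq: "p \<in> S" "q \<in> S" "{p, q} = {a, b}" and c: "c \<in> \<A>" "c \<notin> {p, q}"
      and odd_pc: "odd (card (c \<inter> p))" and even_qc: "even (card (c \<inter> q))" for p q c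
  proof -
    have pqA: "p \<in> \<A>" "q \<in> \<A>" "p \<noteq> q" using pq S(1) ab(3) by auto
    have odd_pq: "odd (card (p \<inter> q))"
      using pq(3) ab(4) by (auto simp: doubleton_eq_iff Int_commute)
    have edges: "{p, q} \<in> E" "{c, p} \<in> E" "{p, q} \<noteq> {c, p}"
      using c odd_pc odd_pq pqA by (auto intro!: edgeI simp: doubleton_eq_iff)
    have only: "{A, B} = {p, q} \<or> {A, B} = {c, p}"
      if "A \<in> \<A>" "B \<in> \<A>" "A \<noteq> B" "odd (card (A \<inter> B))" for A B
      using two_edges[OF edgeI[OF that] edges(1,2)] edges(3) by metis
    have nbr_p: "A \<in> {p, q, c}" if "A \<in> S" "odd (card (A \<inter> p))" for A
      using only[of A p] that S(1) pqA(1) by blast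
    have nbr_c: "A \<in> {c, p}" if "A \<in> S" "odd (card (A \<inter> c))" for A
      using only[of A c] that S(1) c by blast
    show False
    proof (cases "c \<in> S")
      case True
      have "{A \<in> S. odd (card (A \<inter> p))} = {p, q, c}"
        using nbr_p pq(1,2) True assms(3)[OF pqA(1)] odd_pc odd_pq
        by (intro equalityI subsetI) (auto simp: Int_commute)
      moreover have "p \<noteq> q" "p \<noteq> c" "q \<noteq> c" using c(2) pqA(3) by blast+
      ultimately show False using parity[OF S(1,3) pqA(1)] by simp
    next
      case False
      have "{A \<in> S. odd (card (A \<inter> c))} = {p}"
        using nbr_c pq(1) False odd_pc
        by (intro equalityI subsetI) (auto simp: Int_commute)
      then show False using parity[OF S(1,3) c(1)] by simp
    qed
  qed
  define v where "v = sym_diff a b"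
  have even_v: "even (card (c \<inter> v))" if c: "c \<in> \<A>" for c
  proof (rule ccontr)
    assume "odd (card (c \<inter> v))"
    moreover have "c \<inter> v = sym_diff (c \<inter> a) (c \<inter> b)" by (auto simp: v_def)
    ultimately have ne: "even (card (c \<inter> a)) \<longleftrightarrow> odd (card (c \<inter> b))"
      using fin[OF c] by (simp add: even_card_sym_diff)
    \<comment> \<open>Both \<open>a\<close> and \<open>b\<close> are orthogonal to
      \<open>a + b\<close>, because \<open>card a\<close>, \<open>card b\<close> and
      \<open>card (a \<inter> b)\<close> are all odd.\<close>
    then have "c \<notin> {a, b}" using ab(4) abA assms(3) by (auto simp: Int_commute)
    then show False using ne path[of a b c] path[of b a c] ab c by auto
  qed
  obtain x where x: "x \<in> v" using ab(3) by (auto simp: v_def)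
  have v_sub: "v \<subseteq> {1..n}" using abA assms(2) by (auto simp: v_def)
  let ?V = "Pow {1..n} - {{x}}"
  have "card ?V < 2 ^ n" using x v_sub by (simp add: card_Pow card_Diff_singleton_if) auto
  also have "(2::nat) ^ n \<le> 2 ^ card (\<A> - {a})" using assms(4) abA finA by simp
  finally have less: "card ?V < 2 ^ card (\<A> - {a})" .
  have val: "{y \<in> {1..n}. odd (card {A \<in> T. y \<in> A})} \<in> ?V" (is "?w \<in> _")
    if "T \<subseteq> \<A> - {a}" for T
  proof -
    have "finite T" "finite v" using that finA v_sub by (auto intro: finite_subset)
    moreover have "{A \<in> T. odd (card (A \<inter> v))} = {}" using that even_v by auto
    ultimately have "even (card {y \<in> v. odd (card {A \<in> T. y \<in> A})})"
      using even_double_count[of T v] by (metis (no_types, lifting) card.empty even_zero)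
    moreover have "{y \<in> v. odd (card {A \<in> T. y \<in> A})} = ?w \<inter> v" using v_sub by auto
    ultimately have "?w \<noteq> {x}" using x by auto
    then show ?thesis by blast
  qed
  obtain S' where S': "S' \<subseteq> \<A> - {a}" "S' \<noteq> {}" "zero_sum S'"
    using exists_zero_sum_subfamily[OF _ _ _ less val] finA assms(2) by blast
  then have S'A: "S' \<subseteq> \<A>" by blast
  obtain p where "p \<in> S'" using S'(2) by blast
  with neighbour[OF S'A S'(3) this] obtain q
    where pq: "p \<in> S'" "q \<in> S'" "p \<noteq> q" "odd (card (p \<inter> q))" by auto
  \<comment> \<open>Each member of \<open>S'\<close> lies on an edge inside \<open>S'\<close>. Such
    an edge avoids \<open>a\<close>, so it differs from \<open>{a, b}\<close> and must be
    \<open>{p, q}\<close>.\<close>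
  have "S' \<subseteq> {p, q}"
  proof
    fix c assume c: "c \<in> S'"
    then obtain d where d: "d \<in> S'" "d \<noteq> c" "odd (card (c \<inter> d))"
      using neighbour[OF S'A S'(3) c] by blast
    have "{c, d} \<in> E" "{p, q} \<in> E" "{a, b} \<in> E"
      using c d pq ab abA S'A by (auto intro!: edgeI)
    moreover have "{c, d} \<noteq> {a, b}" "{p, q} \<noteq> {a, b}" using c d pq S'(1) by auto
    ultimately have "{c, d} = {p, q}" using two_edges by metis
    then show "c \<in> {p, q}" by blast
  qed
  then have "S' = {p, q}" using pq by blast
  then show False using zero_sum_pair_eq[of p q] S'(3) pq(3) by simp
qed

end
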